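(* Let $X$ be a reflexive Banach space, let $K$ be a nonempty convex closed subset of $X$, let $D\subseteq K$ be a self segment-dense set in $K$ with respect to the weak topology of $X$, and let $\varphi:K\times K\to\mathbb{R}$ be a function satisfying: (i) for all $y\in D$, the function $x\mapsto\varphi(x,y)$ is weakly upper semicontinuous on $K$; (ii) for all $x\in K$, the function $y\mapsto\varphi(x,y)$ is weakly upper semicontinuous on $K\setminus D$; (iii) for all $x\in K$, the function $y\mapsto\varphi(x,y)$ is convex on $D$; (iv) for all $x\in D$, $\varphi(x,x)\ge0$; (v) there exists $r>0$ such that for all $x\in K$ with $\|x\|\le r$ there exists $y_0\in D$ with $\|y_0\|<r$ and $\varphi(x,y_0)=0$. Then there exists an element $x_0\in K$ such that $\varphi(x_0,y)\ge0$ for all $y\in K$.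
   Context: Self segment-dense: for $U\subseteq V\subseteq X$ with $V$ convex and $X$ equipped with a vector topology (here the weak topology), $U$ is self segment-dense in $V$ if $U$ is dense in $V$ (i.e. $V\subseteq\operatorname{cl}(U)$) and for all $x,y\in U$ the set $[x,y]\cap U$ is dense in the closed segment $[x,y]=\{x+t(y-x):t\in[0,1]\}$. A real function $f$ on a topological space $A$ is upper semicontinuous at $x_0\in A$ if for every $\epsilon>0$ there is a neighborhood $M$ of $x_0$ in $A$ such that $f(x)\le f(x_0)+\epsilon$ for all $x\in M$. A function on $K$ is weakly upper semicontinuous on $S\subseteq K$ if, as a function on $K$ equipped with the topology induced by the weak topology of $X$, it is upper semicontinuous at each point of $S$. A real function $f$ is convex on a (not necessarily convex) set $D$ if for all $x_1,\dots,x_n\in D$ and $\lambda_i\ge0$ with $\sum_{i=1}^n\lambda_i=1$ and $\sum_{i=1}^n\lambda_ix_i\in D$ one has $\sum_{i=1}^n\lambda_if(x_i)\ge f\left(\sum_{i=1}^n\lambda_ix_i\right)$.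
   Formalization: Condition (v) additionally requires that K contain some x with ‖x‖ ≤ r; without this (v) can hold vacuously and the claim fails, e.g. X = ℝ, K = D = [10,∞), φ(x,y) = x − y, r = 1. *)

theory Defs
  imports "HOL-Analysis.Analysis"
begin

definition weak_topology :: "'a::real_normed_vector topology" where
  "weak_topology =
     topology_generated_by {blinfun_apply f -` S | (f :: 'a \<Rightarrow>\<^sub>L real) S. open S}"

lemma topspace_weak_topology [simp]: "topspace weak_topology = UNIV"
  unfolding weak_topology_def topology_generated_by_topspace
  by (auto intro!: exI[of _ UNIV])

lemma continuous_map_weak_topology_blinfun:
  fixes f :: "'a::real_normed_vector \<Rightarrow>\<^sub>L real"
  shows "continuous_map weak_topology euclidean (blinfun_apply f)"
  unfolding continuous_map_alt
proof (intro conjI allI impI)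
  fix S :: "real set" assume "openin euclidean S"
  then have "openin weak_topology (blinfun_apply f -` S)"
    unfolding weak_topology_def by (intro topology_generated_by_Basis) auto
  then show "openin weak_topology (blinfun_apply f -` S \<inter> topspace weak_topology)"
    by simp
qed auto

definition bidual_embedding ::
    "'a::real_normed_vector \<Rightarrow> (('a \<Rightarrow>\<^sub>L real) \<Rightarrow>\<^sub>L real)" where
  "bidual_embedding x = Blinfun (\<lambda>f. blinfun_apply f x)"

lemma bidual_embedding_apply [simp]:
  "blinfun_apply (bidual_embedding x) f = blinfun_apply f x"
  unfolding bidual_embedding_def
  by (subst bounded_linear_Blinfun_apply)
    (auto intro: bounded_linear_intros)

definition reflexive_space :: "'a::real_normed_vector itself \<Rightarrow> bool" where
  "reflexive_space _ \<longleftrightarrow> surj (bidual_embedding :: 'a \<Rightarrow> (('a \<Rightarrow>\<^sub>L real) \<Rightarrow>\<^sub>L real))"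

definition self_segment_dense ::
    "'a::real_vector topology \<Rightarrow> 'a set \<Rightarrow> 'a set \<Rightarrow> bool" where
  "self_segment_dense T U V \<longleftrightarrow>
     U \<subseteq> V \<and> convex V \<and> V \<subseteq> T closure_of U \<and>
     (\<forall>x\<in>U. \<forall>y\<in>U. closed_segment x y \<subseteq> T closure_of (closed_segment x y \<inter> U))"

definition upper_semicontinuous_at ::
    "'a topology \<Rightarrow> ('a \<Rightarrow> real) \<Rightarrow> 'a \<Rightarrow> bool" where
  "upper_semicontinuous_at T f x0 \<longleftrightarrow>
     (\<forall>\<epsilon>>0. \<exists>M. openin T M \<and> x0 \<in> M \<and> (\<forall>x\<in>M. f x \<le> f x0 + \<epsilon>))"

text \<open>Neighbourhoods are taken in all of \<open>K\<close>, not in \<open>S\<close>: this is more than upper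
  semicontinuity of the restriction of \<open>f\<close> to \<open>S\<close>.\<close>

definition weakly_usc_on ::
    "'a::real_normed_vector set \<Rightarrow> 'a set \<Rightarrow> ('a \<Rightarrow> real) \<Rightarrow> bool" where
  "weakly_usc_on K S f \<longleftrightarrow>
     (\<forall>x0\<in>S. upper_semicontinuous_at (subtopology weak_topology K) f x0)"

text \<open>Unlike for the library's \<^const>\<open>convex_on\<close>, the set \<open>D\<close> need not be convex, so
  the inequality for two points would not imply the one for \<open>n\<close> points.\<close>

definition convex_fun_on :: "'a::real_vector set \<Rightarrow> ('a \<Rightarrow> real) \<Rightarrow> bool" where
  "convex_fun_on D f \<longleftrightarrow>
     (\<forall>(n::nat) (x :: nat \<Rightarrow> 'a) (l :: nat \<Rightarrow> real).
        (\<forall>i\<in>{1..n}. x i \<in> D \<and> l i \<ge> 0) \<and> (\<Sum>i=1..n. l i) = 1 \<and>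
        (\<Sum>i=1..n. l i *\<^sub>R x i) \<in> D \<longrightarrow>
        (\<Sum>i=1..n. l i * f (x i)) \<ge> f (\<Sum>i=1..n. l i *\<^sub>R x i))"

end

theory Submission
  imports Defs
begin

text \<open>Weak upper semicontinuity makes the sets \<open>G y = {x \<in> K. 0 \<le> \<phi> x y}\<close> weakly closed in \<open>K\<close>
  for \<open>y \<in> D\<close>. Convexity and \<open>\<phi> x x \<ge> 0\<close> show that \<open>G\<close> covers \<open>convex hull T \<inter> D\<close> in the sense of
  Knaster--Kuratowski--Mazurkiewicz for finite \<open>T \<subseteq> D\<close>; self segment-density makes this set weakly
  dense in \<open>convex hull T\<close>, so \<open>G\<close> is a KKM map. As \<open>K \<inter> cball 0 r\<close> is weakly compact, some \<open>x0\<close>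
  in it satisfies \<open>\<phi> x0 y \<ge> 0\<close> for all \<open>y \<in> D\<close> with \<open>norm y < r\<close>. A zero \<open>y0 \<in> D\<close> of \<open>\<phi> x0\<close> with
  \<open>norm y0 < r\<close> lets one reach any \<open>y \<in> D\<close>: a point of \<open>D\<close> on \<open>[y0, y]\<close> near \<open>y0\<close> has norm below
  \<open>r\<close>, and convexity transfers the sign to \<open>y\<close>. Upper semicontinuity in the second argument
  extends the inequality from \<open>D\<close> to \<open>K\<close>.\<close>

subsection \<open>Brouwer and Knaster--Kuratowski--Mazurkiewicz on simplices\<close>

text \<open>A countable product of intervals is compact and metrizable at once, so sequential limits
  and \<open>infdist\<close> are available uniformly in the dimension.\<close>

abbreviation hilbert_cube :: "(nat \<Rightarrow> real) set" where
  "hilbert_cube \<equiv> {x. \<forall>i. x i \<in> {0..1}}"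

lemma compact_hilbert_cube: "compact hilbert_cube"
proof -
  have "compactin (product_topology (\<lambda>i::nat. euclidean::real topology) UNIV) (PiE UNIV (\<lambda>i. {0..1}))"
    by (subst compactin_PiE) auto
  moreover have "PiE UNIV (\<lambda>i::nat. {0..1::real}) = hilbert_cube"
    by (auto simp: PiE_iff)
  ultimately show ?thesis
    by (simp add: euclidean_product_topology)
qed

lemma tendsto_funI:
  fixes X :: "nat \<Rightarrow> nat \<Rightarrow> real"
  assumes "\<And>i. (\<lambda>k. X k i) \<longlonglongrightarrow> l i"
  shows "X \<longlonglongrightarrow> l"
  using assms limitin_componentwise[of "\<lambda>i::nat. euclidean::real topology" UNIV X l sequentially]
  by (simp add: euclidean_product_topology)

lemma tendsto_funD:
  fixes X :: "nat \<Rightarrow> nat \<Rightarrow> real"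
  assumes "X \<longlonglongrightarrow> l"
  shows "(\<lambda>k. X k i) \<longlonglongrightarrow> l i"
  using assms limitin_componentwise[of "\<lambda>i::nat. euclidean::real topology" UNIV X l sequentially]
  by (simp add: euclidean_product_topology)

text \<open>The dimension is a number rather than a type, so that it may depend on the finite family
  to which Knaster--Kuratowski--Mazurkiewicz is applied; the library's fixed point theorem
  needs a Euclidean type. Coordinates from \<open>n\<close> on play no role.\<close>

lemma brouwer_hilbert_cube:
  fixes f :: "(nat \<Rightarrow> real) \<Rightarrow> nat \<Rightarrow> real"
  assumes cont: "\<And>i. i < n \<Longrightarrow> continuous_on hilbert_cube (\<lambda>x. f x i)"
    and maps: "\<And>x i. x \<in> hilbert_cube \<Longrightarrow> i < n \<Longrightarrow> f x i \<in> {0..1}"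
  shows "\<exists>x\<in>hilbert_cube. \<forall>i<n. f x i = x i"
proof -
  \<comment> \<open>The grid of mesh \<open>1 / p\<close> in the first \<open>n\<close> coordinates;
    the others are filled with 0.\<close>
  define pt :: "nat \<Rightarrow> (nat \<Rightarrow> nat) \<Rightarrow> nat \<Rightarrow> real" where
    "pt p x = (\<lambda>i. if i < n then real (x i) / real p else 0)" for p x
  have pt_cube: "pt p x \<in> hilbert_cube" if "\<And>i. i < n \<Longrightarrow> x i \<le> p" for p x
    using that by (auto simp: pt_def divide_le_eq_1)
  \<comment> \<open>An approximate fixed point: near \<open>q\<close> there is, for each coordinate,
    one point where \<open>f\<close> does not raise it and one where \<open>f\<close> does not lower
    it.\<close>
  define S where "S p q a b \<longleftrightarrow> q \<in> hilbert_cube \<and>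
      (\<forall>i<n. a i \<in> hilbert_cube \<and> b i \<in> hilbert_cube \<and>
         (\<forall>j. \<bar>a i j - q j\<bar> \<le> 1 / real p \<and> \<bar>b i j - q j\<bar> \<le> 1 / real p) \<and>
         f (a i) i \<le> a i i \<and> f (b i) i \<ge> b i i)" for p q a b
  have step: "\<exists>q a b. S p q a b" if p: "p > 0" for p :: nat
  proof -
    \<comment> \<open>Kuhn's labelling: inside the grid, 0 means that \<open>f\<close> does not
      lower coordinate \<open>i\<close>. The faces \<open>x i = 0\<close> and \<open>x i = p\<close>
      get the labels 0 and 1 that \<open>kuhn_lemma\<close> requires; as \<open>f\<close> maps into
      the unit interval, these labels still give the right inequality.\<close>
    define label :: "(nat \<Rightarrow> nat) \<Rightarrow> nat \<Rightarrow> nat" where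
      "label x i = (if x i = 0 \<or> (x i < p \<and> f (pt p x) i \<ge> pt p x i) then 0 else 1)" for x i
    obtain q where q: "\<forall>i<n. q i < p"
      and rs: "\<forall>i<n. \<exists>r s. (\<forall>j<n. q j \<le> r j \<and> r j \<le> q j + 1) \<and>
          (\<forall>j<n. q j \<le> s j \<and> s j \<le> q j + 1) \<and> label r i \<noteq> label s i"
      by (rule kuhn_lemma[of p n label]) (use p in \<open>auto simp: label_def\<close>)
    have near: "\<bar>pt p r j - pt p q j\<bar> \<le> 1 / real p" if "\<forall>j<n. q j \<le> r j \<and> r j \<le> q j + 1" for r j
      using that p by (cases "j < n") (auto simp: pt_def diff_divide_distrib[symmetric] divide_simps)
    have cube: "pt p r \<in> hilbert_cube" if "\<forall>j<n. q j \<le> r j \<and> r j \<le> q j + 1" for r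
    proof (rule pt_cube)
      fix i assume "i < n"
      then have "r i \<le> q i + 1" "q i < p" using that q by auto
      then show "r i \<le> p" by simp
    qed
    define Q where "Q i a b \<longleftrightarrow> a \<in> hilbert_cube \<and> b \<in> hilbert_cube \<and>
         (\<forall>j. \<bar>a j - pt p q j\<bar> \<le> 1 / real p \<and> \<bar>b j - pt p q j\<bar> \<le> 1 / real p) \<and>
         f a i \<le> a i \<and> f b i \<ge> b i" for i a b
    have ab: "\<exists>a b. Q i a b" if i: "i < n" for i
    proof -
      have low: "f (pt p r) i \<ge> pt p r i"
        if "\<forall>j<n. q j \<le> r j \<and> r j \<le> q j + 1" "label r i = 0" for r
        using that maps[OF cube i, of r] i by (auto simp: label_def pt_def split: if_splits)
      have high: "f (pt p r) i \<le> pt p r i"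
        if r: "\<forall>j<n. q j \<le> r j \<and> r j \<le> q j + 1" and "label r i \<noteq> 0" for r
      proof (cases "r i = p")
        case True
        then show ?thesis using maps[OF cube[OF r] i] i p by (simp add: pt_def)
      next
        case False
        have "r i \<le> q i + 1" "q i < p" using r q i by auto
        then show ?thesis using that False by (auto simp: label_def split: if_splits)
      qed
      obtain r s where r: "\<forall>j<n. q j \<le> r j \<and> r j \<le> q j + 1"
        and s: "\<forall>j<n. q j \<le> s j \<and> s j \<le> q j + 1" and ne: "label r i \<noteq> label s i"
        using rs i by blast
      show ?thesis
      proof (cases "label r i = 0")
        case True
        then have "f (pt p s) i \<le> pt p s i" "f (pt p r) i \<ge> pt p r i"
          using high[OF s] low[OF r] ne by auto
        then show ?thesis using cube[OF r] cube[OF s] near[OF r] near[OF s] unfolding Q_def by blast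
      next
        case False
        then have "label s i = 0" using ne by (auto simp: label_def split: if_splits)
        then have "f (pt p r) i \<le> pt p r i" "f (pt p s) i \<ge> pt p s i"
          using high[OF r False] low[OF s] by auto
        then show ?thesis using cube[OF r] cube[OF s] near[OF r] near[OF s] unfolding Q_def by blast
      qed
    qed
    have "pt p q \<in> hilbert_cube"
      using q by (intro pt_cube) (simp add: less_imp_le)
    moreover obtain a b where "\<forall>i<n. Q i (a i) (b i)"
      using ab by metis
    ultimately show ?thesis unfolding Q_def S_def by (intro exI[of _ "pt p q"] exI[of _ a] exI[of _ b]) simp
  qed
  \<comment> \<open>Now the mesh \<open>1 / Suc k\<close> tends to 0. Along a subsequence the base
    points converge, the nearby points have the same limit, and continuity turns the two opposite
    inequalities into an equality.\<close>
  have "\<forall>k. \<exists>q a b. S (Suc k) q a b" by (intro allI step) simp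
  then obtain q a b where S: "\<And>k. S (Suc k) (q k) (a k) (b k)" by metis
  have q: "q k \<in> hilbert_cube" for k using S[of k] by (simp add: S_def)
  have a: "a k i \<in> hilbert_cube" and b: "b k i \<in> hilbert_cube"
    and aq: "\<bar>a k i j - q k j\<bar> \<le> 1 / real (Suc k)"
    and bq: "\<bar>b k i j - q k j\<bar> \<le> 1 / real (Suc k)"
    and fa: "f (a k i) i \<le> a k i i" and fb: "f (b k i) i \<ge> b k i i" if "i < n" for k i j
    using S[of k, unfolded S_def] that by blast+
  obtain z \<rho> where z: "z \<in> hilbert_cube" and \<rho>: "strict_mono (\<rho> :: nat \<Rightarrow> nat)"
    and lim: "(q \<circ> \<rho>) \<longlonglongrightarrow> z"
    using compact_hilbert_cube[unfolded compact_def] q by blast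
  have "f z i = z i" if i: "i < n" for i
  proof -
    have lim0: "(\<lambda>k. 1 / real (Suc (\<rho> k))) \<longlonglongrightarrow> 0"
      using LIMSEQ_subseq_LIMSEQ[OF LIMSEQ_Suc[OF lim_1_over_n] \<rho>] by (simp add: o_def)
    have close: "(\<lambda>k. c (\<rho> k)) \<longlonglongrightarrow> z"
      if c: "\<And>k j. \<bar>c k j - q k j\<bar> \<le> 1 / real (Suc k)" for c
    proof (rule tendsto_funI)
      fix j
      have "(\<lambda>k. c (\<rho> k) j - q (\<rho> k) j) \<longlonglongrightarrow> 0"
        by (rule Lim_null_comparison[OF _ lim0]) (use c in simp)
      from tendsto_add[OF this tendsto_funD[OF lim, of j]]
      show "(\<lambda>k. c (\<rho> k) j) \<longlonglongrightarrow> z j" by simp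
    qed
    have la: "(\<lambda>k. a (\<rho> k) i) \<longlonglongrightarrow> z" and lb: "(\<lambda>k. b (\<rho> k) i) \<longlonglongrightarrow> z"
      using close[of "\<lambda>k. a k i"] close[of "\<lambda>k. b k i"] aq bq i by auto
    have "(\<lambda>k. f (a (\<rho> k) i) i) \<longlonglongrightarrow> f z i"
      by (rule continuous_on_tendsto_compose[OF cont[OF i] la z]) (use a[OF i] in simp)
    then have "f z i \<le> z i"
      by (rule LIMSEQ_le[OF _ tendsto_funD[OF la]]) (use fa[OF i] in auto)
    moreover have "(\<lambda>k. f (b (\<rho> k) i) i) \<longlonglongrightarrow> f z i"
      by (rule continuous_on_tendsto_compose[OF cont[OF i] lb z]) (use b[OF i] in simp)
    then have "z i \<le> f z i"
      by (rule LIMSEQ_le[OF tendsto_funD[OF lb]]) (use fb[OF i] in auto)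
    ultimately show ?thesis by simp
  qed
  with z show ?thesis by blast
qed

section \<open>The covering lemma on the standard simplex, from Brouwer's theorem\<close>

definition std_simplex :: "nat \<Rightarrow> (nat \<Rightarrow> real) set" where
  "std_simplex n = {x. (\<forall>i. 0 \<le> x i) \<and> (\<forall>i\<ge>n. x i = 0) \<and> (\<Sum>i<n. x i) = 1}"

text \<open>If the \<open>F i\<close> had no common point, Brouwer's theorem would apply to \<open>x \<mapsto> d (h x) / s (h x)\<close>,
  where \<open>h\<close> retracts the cube onto the simplex, \<open>d i\<close> is the distance to \<open>F i\<close> and \<open>s\<close> the sum of
  the \<open>d i\<close>. At a fixed point, \<open>x i > 0\<close> holds exactly when \<open>x \<notin> F i\<close>, contradicting the covering.\<close>

lemma kkm_simplex:
  assumes n: "n > 0"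
    and closed: "\<And>i. i < n \<Longrightarrow> closed (F i)"
    and cover: "\<And>x. x \<in> std_simplex n \<Longrightarrow> \<exists>i<n. 0 < x i \<and> x \<in> F i"
  shows "\<exists>x\<in>std_simplex n. \<forall>i<n. x \<in> F i"
proof (rule ccontr)
  assume none: "\<not> ?thesis"
  \<comment> \<open>\<open>c x\<close> is the amount by which the coordinate sum falls short of 1.
    Adding it to every coordinate keeps the normalising divisor \<open>R x\<close> positive even at
    the origin; on the simplex it vanishes and \<open>R x\<close> is 1.\<close>
  define c :: "(nat \<Rightarrow> real) \<Rightarrow> real" where "c x = max 0 (1 - (\<Sum>i<n. x i))" for x
  define R :: "(nat \<Rightarrow> real) \<Rightarrow> real" where "R x = (\<Sum>i<n. x i) + real n * c x" for x
  define h :: "(nat \<Rightarrow> real) \<Rightarrow> nat \<Rightarrow> real"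
    where "h x = (\<lambda>i. if i < n then (x i + c x) / R x else 0)" for x
  define d where "d i x = infdist x (F i)" for i x
  define s where "s x = (\<Sum>i<n. d i x)" for x
  have Rpos: "R x > 0" if "x \<in> hilbert_cube" for x
  proof (cases "(\<Sum>i<n. x i) > 0")
    case True
    then show ?thesis by (simp add: R_def c_def add_pos_nonneg)
  next
    case False
    moreover have "(\<Sum>i<n. x i) \<ge> 0" using that by (simp add: sum_nonneg)
    ultimately have "(\<Sum>i<n. x i) = 0" by simp
    then show ?thesis using n by (simp add: R_def c_def)
  qed
  have h_simplex: "h x \<in> std_simplex n" if x: "x \<in> hilbert_cube" for x
  proof -
    have "(\<Sum>i<n. h x i) = (\<Sum>i<n. (x i + c x) / R x)" by (simp add: h_def)
    also have "\<dots> = R x / R x"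
      unfolding sum_divide_distrib[symmetric] by (simp add: sum.distrib R_def)
    finally have "(\<Sum>i<n. h x i) = 1" using Rpos[OF x] by simp
    moreover have "0 \<le> x i" for i using x by simp
    ultimately show ?thesis using Rpos[OF x] by (simp add: std_simplex_def h_def c_def)
  qed
  have h_id: "h x i = x i" if "x \<in> hilbert_cube" "(\<Sum>i<n. x i) = 1" "i < n" for x i
    using that by (simp add: h_def c_def R_def)
  have F_ne: "F i \<noteq> {}" if i: "i < n" for i
  proof -
    have "(\<lambda>j. if j = i then 1 else 0) \<in> std_simplex n"
      using i by (auto simp: std_simplex_def)
    from cover[OF this] show ?thesis by (auto split: if_splits)
  qed
  have d_zero: "d i x = 0 \<longleftrightarrow> x \<in> F i" if "i < n" for i x
    unfolding d_def using in_closed_iff_infdist_zero[OF closed[OF that] F_ne[OF that]] by simp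
  have d_nonneg: "d i x \<ge> 0" for i x by (simp add: d_def infdist_nonneg)
  have s_pos: "s (h x) > 0" if "x \<in> hilbert_cube" for x
  proof -
    from none h_simplex[OF that] obtain i where "i < n" "h x \<notin> F i" by blast
    then have "d i (h x) > 0" using d_zero d_nonneg[of i "h x"] by fastforce
    then show ?thesis unfolding s_def using \<open>i < n\<close> d_nonneg by (intro sum_pos2[of _ i]) auto
  qed
  have cont_sum: "continuous_on hilbert_cube (\<lambda>x. \<Sum>i<n. x i)"
    by (intro continuous_on_sum continuous_on_subset[OF continuous_on_product_coordinates]) simp
  have cont_h: "continuous_on hilbert_cube h"
  proof (rule continuous_on_coordinatewise_then_product)
    fix i
    have "R x \<noteq> 0" if "x \<in> hilbert_cube" for x using Rpos[OF that] by simp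
    moreover have "continuous_on hilbert_cube (\<lambda>x. x i)"
      by (intro continuous_on_subset[OF continuous_on_product_coordinates]) simp
    moreover have "continuous_on hilbert_cube c"
      unfolding c_def by (intro continuous_intros cont_sum)
    moreover from this have "continuous_on hilbert_cube R"
      unfolding R_def by (intro continuous_intros cont_sum)
    ultimately show "continuous_on hilbert_cube (\<lambda>x. h x i)"
      unfolding h_def by (cases "i < n") (auto intro!: continuous_intros)
  qed
  have cont_d: "continuous_on hilbert_cube (\<lambda>x. d i (h x))" for i
    unfolding d_def by (intro continuous_on_infdist cont_h)
  have "\<exists>x\<in>hilbert_cube. \<forall>i<n. d i (h x) / s (h x) = x i"
  proof (rule brouwer_hilbert_cube)
    fix i assume "i < n"
    have "s (h x) \<noteq> 0" if "x \<in> hilbert_cube" for x using s_pos[OF that] by simp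
    then show "continuous_on hilbert_cube (\<lambda>x. d i (h x) / s (h x))"
      unfolding s_def by (intro continuous_on_divide cont_d continuous_on_sum) auto
  next
    fix x i assume "x \<in> hilbert_cube" "i < n"
    then have "s (h x) > 0" "d i (h x) \<le> s (h x)"
      using s_pos d_nonneg by (auto simp: s_def intro!: member_le_sum)
    then show "d i (h x) / s (h x) \<in> {0..1}"
      using d_nonneg by (simp add: divide_le_eq_1)
  qed
  then obtain x where x: "x \<in> hilbert_cube" and fp: "\<And>i. i < n \<Longrightarrow> d i (h x) / s (h x) = x i"
    by blast
  \<comment> \<open>The quotients sum to 1, so \<open>h\<close> does not move the first
    \<open>n\<close> coordinates of a fixed point. The covering is applied to \<open>h x\<close>,
    since \<open>x\<close> itself may have nonzero coordinates from \<open>n\<close> on.\<close>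
  have "(\<Sum>i<n. x i) = (\<Sum>i<n. d i (h x) / s (h x))" by (simp add: fp)
  also have "\<dots> = 1"
    using s_pos[OF x] by (simp add: sum_divide_distrib[symmetric] s_def)
  finally have hx: "h x i = x i" if "i < n" for i using h_id[OF x _ that] by simp
  obtain i where "i < n" "0 < h x i" "h x \<in> F i" using cover[OF h_simplex[OF x]] by blast
  moreover from this have "d i (h x) = 0" using d_zero by simp
  ultimately show False using fp[of i] hx[of i] by simp
qed

subsection \<open>Hahn--Banach separation\<close>

definition sublinear :: "('a::real_vector \<Rightarrow> real) \<Rightarrow> bool" where
  "sublinear p \<longleftrightarrow> (\<forall>x y. p (x + y) \<le> p x + p y) \<and> (\<forall>c x. c \<ge> 0 \<longrightarrow> p (c *\<^sub>R x) = c * p x)"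

text \<open>The bound for \<open>1 / c\<close> at \<open>c *\<^sub>R x\<close> is the reverse of the
  bound for \<open>c\<close>, so one inequality suffices. This suits functionals defined as infima,
  where upper bounds are easy.\<close>

lemma sublinearI:
  assumes add: "\<And>x y. p (x + y) \<le> p x + p y"
    and zero: "p 0 \<le> 0"
    and scale: "\<And>c x. c > 0 \<Longrightarrow> p (c *\<^sub>R x) \<le> c * p x"
  shows "sublinear p"
  unfolding sublinear_def
proof (intro conjI allI impI add)
  fix c :: real and x assume "c \<ge> 0"
  then consider "c = 0" | "c > 0" by linarith
  then show "p (c *\<^sub>R x) = c * p x"
  proof cases
    case 1
    have "p 0 \<ge> 0" using add[of 0 0] by simp
    with 1 zero show ?thesis by simp
  next
    case 2
    have "p ((1/c) *\<^sub>R (c *\<^sub>R x)) \<le> (1/c) * p (c *\<^sub>R x)"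
      using 2 by (intro scale) simp
    then have "c * p x \<le> p (c *\<^sub>R x)" using 2 by (simp add: field_simps)
    with scale[OF 2, of x] show ?thesis by simp
  qed
qed

lemma sublinear_add: "sublinear p \<Longrightarrow> p (x + y) \<le> p x + p y"
  and sublinear_scale: "sublinear p \<Longrightarrow> c \<ge> 0 \<Longrightarrow> p (c *\<^sub>R x) = c * p x"
  by (auto simp: sublinear_def)

lemma sublinear_zero: "sublinear p \<Longrightarrow> p 0 = 0"
  using sublinear_scale[of p 0 0] by simp

lemma sublinear_minus: "sublinear p \<Longrightarrow> - p (- x) \<le> p x"
  using sublinear_add[of p x "- x"] sublinear_zero[of p] by simp

text \<open>A minimal sublinear functional is linear: it cannot be lowered by the competitor
  \<open>x \<mapsto> inf {q (x + t y) - t q y | t \<ge> 0}\<close>.\<close>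

lemma minimal_sublinear_additive:
  assumes q: "sublinear q"
    and min: "\<And>q'. sublinear q' \<Longrightarrow> (\<And>x. q' x \<le> q x) \<Longrightarrow> q' = q"
  shows "q (x + y) = q x + q y"
proof -
  define g where "g x t = q (x + t *\<^sub>R y) - t * q y" for x t
  define q' where "q' x = (INF t\<in>{0..}. g x t)" for x
  have lower: "- q (- x) \<le> g x t" if "t \<ge> 0" for x t
  proof -
    have "q ((x + t *\<^sub>R y) + (- x)) \<le> q (x + t *\<^sub>R y) + q (- x)" by (rule sublinear_add[OF q])
    then show ?thesis using sublinear_scale[OF q that, of y] by (simp add: g_def)
  qed
  have bdd: "bdd_below (g x ` {0..})" for x
    by (rule bdd_belowI[of _ "- q (- x)"]) (use lower in auto)
  have le: "q' x \<le> g x t" if "t \<ge> 0" for x t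
    unfolding q'_def by (rule cINF_lower[OF bdd]) (use that in simp)
  have ge: "m \<le> q' x" if "\<And>t. t \<ge> 0 \<Longrightarrow> m \<le> g x t" for m x
    unfolding q'_def by (rule cINF_greatest) (use that in auto)
  have "sublinear q'"
  proof (rule sublinearI)
    fix u v
    have 1: "q' (u + v) \<le> g u s + g v t" if "s \<ge> 0" "t \<ge> 0" for s t
    proof -
      have "q' (u + v) \<le> g (u + v) (s + t)" using that by (intro le) simp
      also have "\<dots> = q ((u + s *\<^sub>R y) + (v + t *\<^sub>R y)) - (s + t) * q y"
        by (simp add: g_def algebra_simps)
      also have "\<dots> \<le> q (u + s *\<^sub>R y) + q (v + t *\<^sub>R y) - (s + t) * q y"
        using sublinear_add[OF q] by simp
      finally show ?thesis by (simp add: g_def algebra_simps)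
    qed
    \<comment> \<open>The infimum over the pair \<open>s\<close>, \<open>t\<close> is taken one
      variable at a time: first over \<open>t\<close> with \<open>s\<close> fixed, then over
      \<open>s\<close>.\<close>
    have 2: "q' (u + v) - g u s \<le> q' v" if "s \<ge> 0" for s
      by (rule ge) (use 1[OF that] in \<open>simp add: algebra_simps\<close>)
    have "q' (u + v) - q' v \<le> q' u"
    proof (rule ge)
      fix s :: real assume "s \<ge> 0"
      from 2[OF this] show "q' (u + v) - q' v \<le> g u s" by simp
    qed
    then show "q' (u + v) \<le> q' u + q' v" by simp
  next
    show "q' 0 \<le> 0" using le[of 0 0] sublinear_zero[OF q] by (simp add: g_def)
  next
    fix c :: real and u assume c: "c > 0"
    have "q' (c *\<^sub>R u) / c \<le> q' u"
    proof (rule ge)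
      fix t :: real assume "t \<ge> 0"
      then have "q' (c *\<^sub>R u) \<le> g (c *\<^sub>R u) (c * t)" using c by (intro le) simp
      also have "\<dots> = q (c *\<^sub>R (u + t *\<^sub>R y)) - c * t * q y"
        by (simp add: g_def algebra_simps)
      also have "\<dots> = c * g u t"
        using sublinear_scale[OF q, of c "u + t *\<^sub>R y"] c by (simp add: g_def right_diff_distrib)
      finally show "q' (c *\<^sub>R u) / c \<le> g u t" using c by (simp add: field_simps)
    qed
    then show "q' (c *\<^sub>R u) \<le> c * q' u" using c by (simp add: field_simps)
  qed
  moreover have "q' x \<le> q x" for x using le[of 0 x] by (simp add: g_def)
  ultimately have "q' = q" by (rule min)
  \<comment> \<open>The parameter value 1 in the infimum gives superadditivity.\<close>
  then have "q x \<le> q (x + y) - q y" using le[of 1 x] by (simp add: g_def)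
  with sublinear_add[OF q, of x y] show ?thesis by simp
qed

text \<open>Zorn's lemma: a nonempty chain has a pointwise infimum, finite because its members stay
  above \<open>- p (- x)\<close>. It is subadditive because the smaller of two members can serve in
  both terms.\<close>

lemma exists_minimal_sublinear:
  assumes p: "sublinear p"
  shows "\<exists>q. sublinear q \<and> (\<forall>x. q x \<le> p x) \<and>
    (\<forall>q'. sublinear q' \<longrightarrow> (\<forall>x. q' x \<le> q x) \<longrightarrow> q' = q)"
proof -
  define A where "A = {q. sublinear q \<and> (\<forall>x. q x \<le> p x)}"
  \<comment> \<open>The order is reversed, so that the maximal element supplied by Zorn's lemma is a
    minimal functional.\<close>
  define P :: "('a \<Rightarrow> real) \<Rightarrow> ('a \<Rightarrow> real) \<Rightarrow> bool" where "P f g \<longleftrightarrow> (\<forall>x. g x \<le> f x)" for f g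
  have "\<exists>m\<in>A. \<forall>a\<in>A. P m a \<longrightarrow> a = m"
  proof (rule predicate_Zorn)
    show "partial_order_on A (relation_of P A)"
      by (rule partial_order_on_relation_ofI) (auto simp: P_def intro: order_trans intro!: ext antisym)
  next
    fix C assume C: "C \<in> Chains (relation_of P A)"
    show "\<exists>u\<in>A. \<forall>a\<in>C. P a u"
    proof (cases "C = {}")
      case True
      have "p \<in> A" using p by (simp add: A_def)
      with True show ?thesis by blast
    next
      case False
      have CA: "C \<subseteq> A" using C by (auto simp: Chains_def relation_of_def)
      have chain: "P f g \<or> P g f" if "f \<in> C" "g \<in> C" for f g
        using C that by (auto simp: Chains_def relation_of_def)
      have sub: "sublinear f" if "f \<in> C" for f using that CA by (auto simp: A_def)
      have fp: "f x \<le> p x" if "f \<in> C" for f x using that CA by (auto simp: A_def)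
      define u where "u x = (INF f\<in>C. f x)" for x
      have bdd: "bdd_below ((\<lambda>f. f x) ` C)" for x
      proof (rule bdd_belowI2)
        fix f assume f: "f \<in> C"
        show "- p (- x) \<le> f x" using sublinear_minus[OF sub[OF f], of x] fp[OF f, of "- x"] by simp
      qed
      have le: "u x \<le> f x" if "f \<in> C" for x f
        unfolding u_def by (rule cINF_lower[OF bdd that])
      have ge: "m \<le> u x" if "\<And>f. f \<in> C \<Longrightarrow> m \<le> f x" for m x
        unfolding u_def by (rule cINF_greatest[OF False]) (use that in auto)
      have "sublinear u"
      proof (rule sublinearI)
        fix x y
        have 1: "u (x + y) \<le> f x + g y" if fg: "f \<in> C" "g \<in> C" for f g
        proof -
          obtain h where h: "h \<in> C" "h x \<le> f x" "h y \<le> g y"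
            using chain[OF fg] fg by (auto simp: P_def)
          show ?thesis using le[OF h(1), of "x + y"] sublinear_add[OF sub[OF h(1)], of x y] h by simp
        qed
        have 2: "u (x + y) - f x \<le> u y" if "f \<in> C" for f
          by (rule ge) (use 1[OF that] in \<open>simp add: algebra_simps\<close>)
        have "u (x + y) - u y \<le> u x"
          by (rule ge) (use 2 in \<open>simp add: algebra_simps\<close>)
        then show "u (x + y) \<le> u x + u y" by simp
      next
        obtain f where f: "f \<in> C" using False by blast
        show "u 0 \<le> 0" using le[OF f, of 0] sublinear_zero[OF sub[OF f]] by simp
      next
        fix c :: real and x assume c: "c > 0"
        have "u (c *\<^sub>R x) / c \<le> u x"
        proof (rule ge)
          fix f assume f: "f \<in> C"
          show "u (c *\<^sub>R x) / c \<le> f x"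
            using le[OF f, of "c *\<^sub>R x"] sublinear_scale[OF sub[OF f], of c x] c
            by (simp add: field_simps)
        qed
        then show "u (c *\<^sub>R x) \<le> c * u x" using c by (simp add: field_simps)
      qed
      moreover have "u x \<le> p x" for x
      proof -
        obtain f where "f \<in> C" using False by blast
        then show ?thesis using le[of f x] fp[of f x] by simp
      qed
      ultimately have "u \<in> A" by (simp add: A_def)
      then show ?thesis using le by (auto simp: P_def)
    qed
  qed
  then obtain q where q: "q \<in> A" and min: "\<And>a. a \<in> A \<Longrightarrow> P q a \<Longrightarrow> a = q" by blast
  have "q' = q" if "sublinear q'" "\<forall>x. q' x \<le> q x" for q'
  proof (rule min)
    show "q' \<in> A" using that q by (auto simp: A_def intro: order_trans)
  qed (use that in \<open>simp add: P_def\<close>)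
  then show ?thesis using q by (auto simp: A_def)
qed

text \<open>A minimal sublinear functional below \<open>p\<close> is additive; additivity makes it
  odd, which carries homogeneity over to negative scalars.\<close>

lemma hahn_banach_sublinear:
  assumes "sublinear p"
  shows "\<exists>f. linear f \<and> (\<forall>x. f x \<le> p x)"
proof -
  obtain q where q: "sublinear q" and le: "\<forall>x. q x \<le> p x"
    and min: "\<And>q'. sublinear q' \<Longrightarrow> (\<And>x. q' x \<le> q x) \<Longrightarrow> q' = q"
    using exists_minimal_sublinear[OF assms] by blast
  have add: "q (x + y) = q x + q y" for x y by (rule minimal_sublinear_additive[OF q min])
  have neg: "q (- x) = - q x" for x using add[of x "- x"] sublinear_zero[OF q] by simp
  have "q (c *\<^sub>R x) = c * q x" for c x
  proof (cases "c \<ge> 0")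
    case True
    then show ?thesis by (rule sublinear_scale[OF q])
  next
    case False
    then have "q ((- c) *\<^sub>R x) = (- c) * q x" by (intro sublinear_scale[OF q]) simp
    then show ?thesis using neg[of "c *\<^sub>R x"] by simp
  qed
  then have "linear q" by (intro linearI add) simp
  with le show ?thesis by blast
qed

text \<open>The sublinear functional is \<open>x \<mapsto> inf {\<parallel>x - t (b - z)\<parallel> - t d | t \<ge> 0, b \<in> B}\<close>,
  where \<open>d\<close> is the distance from \<open>z\<close> to \<open>B\<close>; at \<open>b - z\<close> it is at most \<open>- d\<close>.\<close>

lemma separate_point_closed_convex:
  fixes B :: "'a::real_normed_vector set"
  assumes "convex B" "closed B" "z \<notin> B"
  shows "\<exists>(f :: 'a \<Rightarrow>\<^sub>L real) d. d > 0 \<and> (\<forall>b\<in>B. f b \<le> f z - d)"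
proof (cases "B = {}")
  case True
  then show ?thesis by (auto intro: exI[of _ 1])
next
  case False
  define d where "d = infdist z B"
  have d: "d > 0"
    using infdist_nonneg[of z B] in_closed_iff_infdist_zero[OF \<open>closed B\<close> False, of z] \<open>z \<notin> B\<close>
    by (simp add: d_def less_le)
  have dB: "d \<le> norm (b - z)" if "b \<in> B" for b
    using infdist_le[OF that, of z] by (simp add: d_def dist_norm norm_minus_commute)
  define I where "I = {0::real..} \<times> B"
  define g where "g x tb = norm (x - fst tb *\<^sub>R (snd tb - z)) - fst tb * d" for x tb
  define p where "p x = (INF tb\<in>I. g x tb)" for x
  have lower: "- norm x \<le> g x tb" if "tb \<in> I" for x tb
  proof -
    obtain t b where tb: "tb = (t, b)" by (cases tb)
    have "t \<ge> 0" "b \<in> B" using that tb by (auto simp: I_def)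
    then have "t * d \<le> norm (t *\<^sub>R (b - z))" using dB by (simp add: mult_left_mono)
    moreover have "norm (t *\<^sub>R (b - z)) \<le> norm (x - t *\<^sub>R (b - z)) + norm x"
      using norm_triangle_ineq4[of x "x - t *\<^sub>R (b - z)"] by simp
    ultimately show ?thesis by (simp add: g_def tb)
  qed
  have bdd: "bdd_below (g x ` I)" for x
    by (rule bdd_belowI2[of _ "- norm x"]) (use lower in auto)
  have le: "p x \<le> norm (x - t *\<^sub>R (b - z)) - t * d" if "t \<ge> 0" "b \<in> B" for x t b
    using cINF_lower[OF bdd, of "(t, b)" x] that by (simp add: p_def I_def g_def)
  have ge: "m \<le> p x"
    if "\<And>t b. t \<ge> 0 \<Longrightarrow> b \<in> B \<Longrightarrow> m \<le> norm (x - t *\<^sub>R (b - z)) - t * d" for m x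
    unfolding p_def
    by (rule cINF_greatest) (use that False in \<open>auto simp: I_def g_def\<close>)
  obtain b0 where b0: "b0 \<in> B" using False by blast
  have p_norm: "p x \<le> norm x" for x using le[of 0 b0 x] b0 by simp
  have "sublinear p"
  proof (rule sublinearI)
    fix x y
    have 1: "p (x + y) \<le> (norm (x - s *\<^sub>R (a - z)) - s * d) + (norm (y - t *\<^sub>R (b - z)) - t * d)"
      if st: "s \<ge> 0" "t \<ge> 0" and ab: "a \<in> B" "b \<in> B" for s t a b
    proof -
      \<comment> \<open>The cone over \<open>B - z\<close> is closed under addition:
        \<open>e\<close> is the mean of \<open>a\<close> and \<open>b\<close> with weights
        proportional to \<open>s\<close> and \<open>t\<close>, or \<open>a\<close> if both weights
        vanish.\<close>
      obtain e where e: "e \<in> B" "(s + t) *\<^sub>R (e - z) = s *\<^sub>R (a - z) + t *\<^sub>R (b - z)"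
      proof (cases "s + t = 0")
        case True
        then have "s = 0" "t = 0" using st by auto
        then show ?thesis using that[OF ab(1)] by simp
      next
        case False
        then have pos: "s + t > 0" using st by simp
        let ?e = "(s / (s + t)) *\<^sub>R a + (t / (s + t)) *\<^sub>R b"
        have "?e \<in> B"
          using pos st ab by (intro convexD[OF \<open>convex B\<close>]) (auto simp: add_divide_distrib[symmetric])
        moreover have "(s + t) *\<^sub>R ?e = s *\<^sub>R a + t *\<^sub>R b"
          using pos by (simp add: scaleR_add_right)
        then have "(s + t) *\<^sub>R (?e - z) = s *\<^sub>R (a - z) + t *\<^sub>R (b - z)"
          by (simp add: scaleR_diff_right scaleR_add_left)
        ultimately show ?thesis by (rule that)
      qed
      have "p (x + y) \<le> norm ((x + y) - (s + t) *\<^sub>R (e - z)) - (s + t) * d"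
        using st e by (intro le) auto
      also have "(x + y) - (s + t) *\<^sub>R (e - z) = (x - s *\<^sub>R (a - z)) + (y - t *\<^sub>R (b - z))"
        by (simp add: e(2))
      finally show ?thesis
        using norm_triangle_ineq[of "x - s *\<^sub>R (a - z)" "y - t *\<^sub>R (b - z)"]
        by (simp add: algebra_simps)
    qed
    have 2: "p (x + y) - (norm (x - s *\<^sub>R (a - z)) - s * d) \<le> p y" if "s \<ge> 0" "a \<in> B" for s a
    proof (rule ge)
      fix t b assume "0 \<le> (t::real)" "b \<in> B"
      from 1[OF that(1) this(1) that(2) this(2)]
      show "p (x + y) - (norm (x - s *\<^sub>R (a - z)) - s * d) \<le> norm (y - t *\<^sub>R (b - z)) - t * d"
        by linarith
    qed
    have "p (x + y) - p y \<le> p x"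
    proof (rule ge)
      fix t b assume "0 \<le> (t::real)" "b \<in> B"
      from 2[OF this] show "p (x + y) - p y \<le> norm (x - t *\<^sub>R (b - z)) - t * d" by linarith
    qed
    then show "p (x + y) \<le> p x + p y" by simp
  next
    show "p 0 \<le> 0" using p_norm[of 0] by simp
  next
    fix c :: real and x assume c: "c > 0"
    have "p (c *\<^sub>R x) / c \<le> p x"
    proof (rule ge)
      fix t b assume t: "0 \<le> (t::real)" and b: "b \<in> B"
      have "p (c *\<^sub>R x) \<le> norm (c *\<^sub>R x - (c * t) *\<^sub>R (b - z)) - (c * t) * d"
        using c t b by (intro le) auto
      also have "c *\<^sub>R x - (c * t) *\<^sub>R (b - z) = c *\<^sub>R (x - t *\<^sub>R (b - z))"
        by (simp add: scaleR_diff_right)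
      also have "norm \<dots> - (c * t) * d = c * (norm (x - t *\<^sub>R (b - z)) - t * d)"
        using c by (simp add: right_diff_distrib)
      finally show "p (c *\<^sub>R x) / c \<le> norm (x - t *\<^sub>R (b - z)) - t * d"
        using c by (simp add: field_simps)
    qed
    then show "p (c *\<^sub>R x) \<le> c * p x" using c by (simp add: field_simps)
  qed
  then obtain f where f: "linear f" "\<And>x. f x \<le> p x" using hahn_banach_sublinear by blast
  have f_norm: "\<bar>f x\<bar> \<le> norm x" for x
    using f(2)[of x] f(2)[of "- x"] p_norm[of x] p_norm[of "- x"] linear_neg[OF f(1), of x] by simp
  have "bounded_linear f"
    using f(1) f_norm by (auto intro!: bounded_linear_intro[of f 1] simp: linear_add linear_scale)
  then obtain F where F: "blinfun_apply F = f"
    by (metis bounded_linear_Blinfun_apply)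
  have "f b \<le> f z - d" if "b \<in> B" for b
  proof -
    have "f (b - z) \<le> - d" using f(2)[of "b - z"] le[of 1 b "b - z"] that by simp
    then show ?thesis by (simp add: linear_diff[OF f(1)])
  qed
  with d F show ?thesis by blast
qed

lemma separate_points:
  fixes x y :: "'a::real_normed_vector"
  assumes "x \<noteq> y"
  shows "\<exists>f :: 'a \<Rightarrow>\<^sub>L real. f x < f y"
proof -
  obtain f :: "'a \<Rightarrow>\<^sub>L real" and d where "d > 0" "\<forall>b\<in>{x}. f b \<le> f y - d"
    using separate_point_closed_convex[of "{x}" y] assms by auto
  then show ?thesis by (intro exI[of _ f]) simp
qed

subsection \<open>The weak topology\<close>

text \<open>Universal property of an initial topology: subbasic sets are preimages under single
  functionals.\<close>

lemma continuous_map_into_weak_topology: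
  assumes "\<And>f :: 'a::real_normed_vector \<Rightarrow>\<^sub>L real. continuous_map T euclidean (\<lambda>x. f (g x))"
  shows "continuous_map T weak_topology g"
  unfolding weak_topology_def
proof (rule continuous_on_generated_topo)
  fix U assume "U \<in> {blinfun_apply f -` S | (f :: 'a \<Rightarrow>\<^sub>L real) S. open S}"
  then obtain f :: "'a \<Rightarrow>\<^sub>L real" and S where U: "U = blinfun_apply f -` S" "open S" by auto
  have "openin T {x \<in> topspace T. f (g x) \<in> S}"
    by (rule openin_continuous_map_preimage[OF assms[of f]]) (use U(2) in simp)
  moreover have "{x \<in> topspace T. f (g x) \<in> S} = g -` U \<inter> topspace T"
    using U by auto
  ultimately show "openin T (g -` U \<inter> topspace T)" by simp
qed (auto intro!: exI[of _ UNIV])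

text \<open>Evaluation embeds \<open>B\<close> into a product of compact intervals. A limit of its image is a bounded
  linear functional on the dual, hence evaluation at a point by reflexivity, and separation puts
  this point into \<open>B\<close>.\<close>

lemma compactin_weak_convex_closed_bounded:
  fixes B :: "'a::real_normed_vector set"
  assumes refl: "reflexive_space TYPE('a)"
    and B: "convex B" "closed B" "bounded B"
  shows "compactin weak_topology B"
proof -
  obtain r where r: "\<And>x. x \<in> B \<Longrightarrow> norm x \<le> r" using B(3) by (auto simp: bounded_iff)
  define E :: "'a \<Rightarrow> ('a \<Rightarrow>\<^sub>L real) \<Rightarrow> real" where "E x = (\<lambda>f. f x)" for x
  define P :: "(('a \<Rightarrow>\<^sub>L real) \<Rightarrow> real) set" where "P = (\<Pi>\<^sub>E f\<in>UNIV. {- (norm f * r) .. norm f * r})"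
  have coord: "continuous_on UNIV (\<lambda>\<Lambda> :: ('a \<Rightarrow>\<^sub>L real) \<Rightarrow> real. \<Lambda> f)" for f
    by simp
  have "compactin (product_topology (\<lambda>_. euclidean) UNIV) P"
    unfolding P_def by (subst compactin_PiE) auto
  then have "compact P" by (simp add: euclidean_product_topology)
  have EP: "E ` B \<subseteq> P"
  proof
    fix \<Lambda> assume "\<Lambda> \<in> E ` B"
    then obtain x where x: "x \<in> B" "\<Lambda> = E x" by blast
    have "\<bar>f x\<bar> \<le> norm f * r" for f :: "'a \<Rightarrow>\<^sub>L real"
      using norm_blinfun[of f x] r[OF x(1)] by (simp add: mult_left_mono order_trans)
    then show "\<Lambda> \<in> P" by (auto simp: P_def x E_def PiE_iff abs_le_iff minus_le_iff)
  qed
  have "closure (E ` B) \<subseteq> E ` B"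
  proof
    fix \<Lambda> assume \<Lambda>: "\<Lambda> \<in> closure (E ` B)"
    have cl: "\<Lambda> \<in> S" if "closed S" "E ` B \<subseteq> S" for S
      using closure_minimal[OF that(2,1)] \<Lambda> by blast
    have add: "\<Lambda> (f + g) = \<Lambda> f + \<Lambda> g" for f g
    proof -
      have "\<Lambda> \<in> {\<Lambda>. \<Lambda> (f + g) = \<Lambda> f + \<Lambda> g}"
        by (rule cl, intro closed_Collect_eq continuous_on_add coord)
           (auto simp: E_def blinfun.add_left)
      then show ?thesis by simp
    qed
    have scale: "\<Lambda> (c *\<^sub>R f) = c *\<^sub>R \<Lambda> f" for c f
    proof -
      have "\<Lambda> \<in> {\<Lambda>. \<Lambda> (c *\<^sub>R f) = c *\<^sub>R \<Lambda> f}"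
        by (rule cl, intro closed_Collect_eq continuous_on_scaleR continuous_on_const coord)
           (auto simp: E_def blinfun.scaleR_left)
      then show ?thesis by simp
    qed
    have "closed P" unfolding P_def
      using closedin_product_topology[of "\<lambda>_. euclidean" UNIV "\<lambda>f::'a \<Rightarrow>\<^sub>L real. {- (norm f * r) .. norm f * r}"]
      by (simp add: euclidean_product_topology)
    from cl[OF this EP] have "\<bar>\<Lambda> f\<bar> \<le> norm f * r" for f
      by (auto simp: P_def PiE_iff abs_le_iff minus_le_iff)
    then have "bounded_linear \<Lambda>"
      by (intro bounded_linear_intro[of \<Lambda> r]) (use add scale in auto)
    then obtain L :: "('a \<Rightarrow>\<^sub>L real) \<Rightarrow>\<^sub>L real" where L: "blinfun_apply L = \<Lambda>"
      by (metis bounded_linear_Blinfun_apply)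
    obtain z :: 'a where z: "L = bidual_embedding z"
      using refl by (auto simp: reflexive_space_def surj_def)
    have \<Lambda>z: "\<Lambda> f = f z" for f using L z bidual_embedding_apply[of z f] by simp
    have "z \<in> B"
    proof (rule ccontr)
      assume "z \<notin> B"
      then obtain f :: "'a \<Rightarrow>\<^sub>L real" and d where d: "d > 0" "\<forall>b\<in>B. f b \<le> f z - d"
        using separate_point_closed_convex[OF B(1,2)] by blast
      have "\<Lambda> \<in> {\<Lambda>. \<Lambda> f \<le> f z - d}"
        by (rule cl, intro closed_Collect_le continuous_on_const coord) (use d in \<open>auto simp: E_def\<close>)
      then show False using \<Lambda>z[of f] d(1) by simp
    qed
    moreover have "\<Lambda> = E z" by (rule ext) (simp add: \<Lambda>z E_def)
    ultimately show "\<Lambda> \<in> E ` B" by blast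
  qed
  then have "closed (E ` B)" using closure_subset_eq by blast
  then have "compact (E ` B)" using \<open>compact P\<close> EP by (metis compact_Int_closed inf.absorb2)
  have "inj E"
  proof (rule injI)
    fix x y assume "E x = E y"
    then have "f x = f y" for f :: "'a \<Rightarrow>\<^sub>L real" by (metis E_def)
    then show "x = y" using separate_points[of x y] by force
  qed
  \<comment> \<open>Compactness is carried back along the inverse of \<open>E\<close>, which is
    continuous because each functional composed with it is a coordinate projection.\<close>
  have "continuous_map (top_of_set (E ` B)) weak_topology (inv E)"
  proof (rule continuous_map_into_weak_topology)
    fix f :: "'a \<Rightarrow>\<^sub>L real"
    have "continuous_on (E ` B) (\<lambda>\<Lambda>. \<Lambda> f)"
      by (rule continuous_on_subset[OF coord]) simp
    then have "continuous_on (E ` B) (\<lambda>\<Lambda>. f (inv E \<Lambda>))"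
      by (rule continuous_on_eq) (use inv_f_f[OF \<open>inj E\<close>] in \<open>auto simp: E_def[abs_def]\<close>)
    then show "continuous_map (top_of_set (E ` B)) euclidean (\<lambda>\<Lambda>. f (inv E \<Lambda>))" by simp
  qed
  moreover have "compactin (top_of_set (E ` B)) (E ` B)"
    using \<open>compact (E ` B)\<close> by simp
  ultimately have "compactin weak_topology (inv E ` E ` B)" by (rule image_compactin[rotated])
  then show ?thesis by (simp only: image_image inv_f_f[OF \<open>inj E\<close>] image_ident)
qed

section \<open>Self segment-dense sets in the weak topology\<close>

lemma continuous_map_weak_affine:
  "continuous_map weak_topology weak_topology (\<lambda>b::'a::real_normed_vector. c + t *\<^sub>R b)"
proof (rule continuous_map_into_weak_topology)
  fix f :: "'a \<Rightarrow>\<^sub>L real"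
  have "continuous_map weak_topology euclidean (\<lambda>b. f c + t * f b)"
    by (intro continuous_map_add continuous_map_real_mult continuous_map_weak_topology_blinfun) auto
  then show "continuous_map weak_topology euclidean (\<lambda>b. f (c + t *\<^sub>R b))"
    by (simp add: blinfun.add_right blinfun.scaleR_right)
qed

text \<open>Cone over one vertex at a time: a point of \<open>[a, b]\<close> with \<open>b\<close> in the smaller hull is
  approximated by a point of some \<open>[a, b']\<close> with \<open>b' \<in> D\<close>, and that one by points of
  \<open>[a, b'] \<inter> D\<close>.\<close>

lemma self_segment_dense_hull:
  fixes D :: "'a::real_normed_vector set"
  assumes D: "self_segment_dense weak_topology D K" and S: "finite S" "S \<subseteq> D"
  shows "convex hull S \<subseteq> weak_topology closure_of (convex hull S \<inter> D)"
  using S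
proof (induction S)
  case empty
  then show ?case by simp
next
  case (insert a S)
  show ?case
  proof (cases "S = {}")
    case True
    then show ?thesis using insert.prems closure_of_subset[of "{a}" weak_topology] by simp
  next
    case False
    show ?thesis
    proof
      fix w assume "w \<in> convex hull insert a S"
      then obtain u v b where uv: "u \<ge> 0" "v \<ge> 0" "u + v = 1" and b: "b \<in> convex hull S"
        and w: "w = u *\<^sub>R a + v *\<^sub>R b"
        unfolding convex_hull_insert[OF False] by blast
      show "w \<in> weak_topology closure_of (convex hull insert a S \<inter> D)"
        unfolding in_closure_of
      proof (intro conjI allI impI)
        fix T assume T: "w \<in> T \<and> openin weak_topology T"
        \<comment> \<open>Pulling \<open>T\<close> back along the cone map with the weights of
          \<open>w\<close> fixed gives a weak neighbourhood of \<open>b\<close>, to which the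
          induction hypothesis applies.\<close>
        define V where "V = {b \<in> topspace weak_topology. u *\<^sub>R a + v *\<^sub>R b \<in> T}"
        have "openin weak_topology V"
          unfolding V_def using T by (intro openin_continuous_map_preimage[OF continuous_map_weak_affine]) simp
        moreover have "b \<in> V" using T w by (simp add: V_def)
        moreover have "b \<in> weak_topology closure_of (convex hull S \<inter> D)"
          using insert b by auto
        ultimately have "\<exists>b'. b' \<in> convex hull S \<inter> D \<and> b' \<in> V" by (simp only: in_closure_of)
        then obtain b' where b': "b' \<in> convex hull S" "b' \<in> D" "u *\<^sub>R a + v *\<^sub>R b' \<in> T"
          by (auto simp: V_def)
        have "u *\<^sub>R a + v *\<^sub>R b' \<in> closed_segment a b'"
          using uv by (auto simp: closed_segment_def intro!: exI[of _ v])
        then have "u *\<^sub>R a + v *\<^sub>R b' \<in> weak_topology closure_of (closed_segment a b' \<inter> D)"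
          using D insert.prems b'(2) unfolding self_segment_dense_def by blast
        then obtain e where e: "e \<in> closed_segment a b'" "e \<in> D" "e \<in> T"
          using T b'(3) unfolding in_closure_of by blast
        have "a \<in> convex hull insert a S" "b' \<in> convex hull insert a S"
          using b'(1) hull_mono[of S "insert a S" convex] by (auto simp: hull_inc)
        then have "e \<in> convex hull insert a S"
          using e(1) closed_segment_subset[OF _ _ convex_convex_hull] by blast
        with e show "\<exists>y. y \<in> convex hull insert a S \<inter> D \<and> y \<in> T" by blast
      qed simp
    qed
  qed
qed

text \<open>A functional separating \<open>a\<close> from \<open>b\<close> cuts out the points of
  the segment with parameter strictly between 0 and \<open>\<delta>\<close> by a weakly open set. It
  contains the point with parameter \<open>\<delta>/2\<close>, so it meets \<open>D\<close> on the
  segment.\<close>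

lemma self_segment_dense_approach:
  fixes a b :: "'a::real_normed_vector"
  assumes D: "self_segment_dense weak_topology D K" and ab: "a \<in> D" "b \<in> D" "a \<noteq> b"
    and \<delta>: "0 < \<delta>" "\<delta> \<le> 1"
  shows "\<exists>t. 0 < t \<and> t < \<delta> \<and> (1 - t) *\<^sub>R a + t *\<^sub>R b \<in> D"
proof -
  obtain f :: "'a \<Rightarrow>\<^sub>L real" where f: "f a < f b" using separate_points[OF ab(3)] by blast
  define W where "W = {w \<in> topspace weak_topology. f w \<in> {f a <..< f a + \<delta> * (f b - f a)}}"
  have val: "f ((1 - t) *\<^sub>R a + t *\<^sub>R b) = f a + t * (f b - f a)" for t
    by (simp add: blinfun.add_right blinfun.scaleR_right) (simp add: algebra_simps)
  have "openin weak_topology W"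
    unfolding W_def by (rule openin_continuous_map_preimage[OF continuous_map_weak_topology_blinfun]) auto
  moreover define m where "m = (1 - \<delta>/2) *\<^sub>R a + (\<delta>/2) *\<^sub>R b"
  have "m \<in> W" using f \<delta> by (simp add: W_def m_def val)
  moreover have "m \<in> closed_segment a b"
    using \<delta> by (auto simp: closed_segment_def m_def intro!: exI[of _ "\<delta>/2"])
  then have "m \<in> weak_topology closure_of (closed_segment a b \<inter> D)"
    using D ab unfolding self_segment_dense_def by blast
  ultimately obtain e where e: "e \<in> closed_segment a b" "e \<in> D" "e \<in> W"
    unfolding in_closure_of by blast
  then obtain t where t: "e = (1 - t) *\<^sub>R a + t *\<^sub>R b" by (auto simp: closed_segment_def)
  have "0 < t * (f b - f a)" "t * (f b - f a) < \<delta> * (f b - f a)"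
    using e(3) by (auto simp: W_def t val)
  then have "0 < t" "t < \<delta>" using f by (auto simp: zero_less_mult_iff mult_less_cancel_right)
  with e t show ?thesis by blast
qed

subsection \<open>Equilibrium points\<close>

lemma convex_fun_on_finite:
  assumes f: "convex_fun_on D f" and S: "finite S" "S \<subseteq> D"
    and u: "\<And>y. y \<in> S \<Longrightarrow> u y \<ge> 0" "sum u S = 1" and mem: "(\<Sum>y\<in>S. u y *\<^sub>R y) \<in> D"
  shows "f (\<Sum>y\<in>S. u y *\<^sub>R y) \<le> (\<Sum>y\<in>S. u y * f y)"
proof -
  obtain h where h: "bij_betw h {1..card S} S" using ex_bij_betw_nat_finite_1[OF S(1)] by blast
  have re: "(\<Sum>i=1..card S. g (h i)) = sum g S" for g :: "'a \<Rightarrow> real"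
    by (rule sum.reindex_bij_betw[OF h])
  have rx: "(\<Sum>i=1..card S. u (h i) *\<^sub>R h i) = (\<Sum>y\<in>S. u y *\<^sub>R y)"
    by (rule sum.reindex_bij_betw[OF h])
  have "h i \<in> S" if "i \<in> {1..card S}" for i using h that by (auto simp: bij_betw_def)
  then have "\<forall>i\<in>{1..card S}. h i \<in> D \<and> 0 \<le> (u \<circ> h) i" using S u by auto
  then show ?thesis
    using f[unfolded convex_fun_on_def, rule_format, of "card S" h "u \<circ> h"] u mem
      re[of u] re[of "\<lambda>y. u y * f y"] rx by (auto simp: o_def)
qed

lemma convex_fun_on_two:
  assumes f: "convex_fun_on D f" and "a \<in> D" "b \<in> D" "0 \<le> t" "t \<le> 1"
    and "(1 - t) *\<^sub>R a + t *\<^sub>R b \<in> D"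
  shows "f ((1 - t) *\<^sub>R a + t *\<^sub>R b) \<le> (1 - t) * f a + t * f b"
proof -
  let ?x = "\<lambda>i::nat. if i = 1 then a else b" and ?l = "\<lambda>i::nat. if i = 1 then 1 - t else t"
  have 2: "{Suc 0..2} = {Suc 0, 2}" by auto
  show ?thesis
    using f[unfolded convex_fun_on_def, rule_format, of 2 ?x ?l] assms(2-) by (simp add: 2)
qed

lemma weakly_usc_onD:
  assumes "weakly_usc_on K S f" "x0 \<in> S" "e > 0"
  obtains M where "openin (subtopology weak_topology K) M" "x0 \<in> M" "\<And>x. x \<in> M \<Longrightarrow> f x \<le> f x0 + e"
  using assms unfolding weakly_usc_on_def upper_semicontinuous_at_def by meson

lemma closedin_weakly_usc:
  assumes "weakly_usc_on K K f"
  shows "closedin (subtopology weak_topology K) {x \<in> K. 0 \<le> f x}"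
proof -
  have "openin (subtopology weak_topology K) {x \<in> K. f x < 0}"
  proof (subst openin_subopen, intro ballI)
    fix x0 assume x0: "x0 \<in> {x \<in> K. f x < 0}"
    \<comment> \<open>Half of the gap to 0 as tolerance keeps the values near \<open>x0\<close>
      below \<open>f x0 / 2\<close>, hence negative.\<close>
    then have "x0 \<in> K" "- f x0 / 2 > 0" by auto
    then obtain M where M: "openin (subtopology weak_topology K) M" "x0 \<in> M"
      "\<And>x. x \<in> M \<Longrightarrow> f x \<le> f x0 + - f x0 / 2"
      using weakly_usc_onD[OF assms] by metis
    have "M \<subseteq> {x \<in> K. f x < 0}"
    proof
      fix x assume "x \<in> M"
      moreover have "M \<subseteq> K" using openin_subset[OF M(1)] by simp
      ultimately show "x \<in> {x \<in> K. f x < 0}" using M(3)[of x] x0 by auto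
    qed
    with M show "\<exists>T. openin (subtopology weak_topology K) T \<and> x0 \<in> T \<and> T \<subseteq> {x \<in> K. f x < 0}"
      by blast
  qed
  moreover have "K - {x \<in> K. 0 \<le> f x} = {x \<in> K. f x < 0}" by auto
  ultimately show ?thesis by (simp add: closedin_def)
qed

text \<open>For \<open>y\<close> outside \<open>D\<close>, density puts points of \<open>D\<close>
  into every neighbourhood of \<open>y\<close>, so \<open>f y + e\<close> is at least a nonnegative
  value. It matters that neighbourhoods are open in \<open>K\<close>: inside \<open>K - D\<close>
  they would contain no point of \<open>D\<close>.\<close>

lemma weakly_usc_nonneg_extend:
  assumes f: "weakly_usc_on K (K - D) f" and dense: "K \<subseteq> weak_topology closure_of D" and "D \<subseteq> K"
    and nonneg: "\<And>y. y \<in> D \<Longrightarrow> 0 \<le> f y" and y: "y \<in> K"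
  shows "0 \<le> f y"
proof (cases "y \<in> D")
  case True
  then show ?thesis by (rule nonneg)
next
  case False
  show ?thesis
  proof (rule field_le_epsilon)
    fix e :: real assume "e > 0"
    then obtain M where M: "openin (subtopology weak_topology K) M" "y \<in> M"
      "\<And>x. x \<in> M \<Longrightarrow> f x \<le> f y + e"
      using weakly_usc_onD[OF f, of y e] y False by blast
    from M(1) obtain W where W: "openin weak_topology W" "M = W \<inter> K"
      by (auto simp: openin_subtopology)
    have "y \<in> weak_topology closure_of D" using dense y by blast
    then obtain d where "d \<in> D" "d \<in> W"
      using M(2) W unfolding in_closure_of by blast
    then show "0 \<le> f y + e" using M(3)[of d] W nonneg[of d] \<open>D \<subseteq> K\<close> by force
  qed
qed

text \<open>The barycentric map \<open>L\<close> from the simplex onto the hull of \<open>S\<close>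
  is weakly continuous and pulls the sets \<open>G y\<close> back to closed sets, which reduces the
  claim to \<open>kkm_simplex\<close>.\<close>

lemma knaster_kuratowski_mazurkiewicz:
  fixes K :: "'a::real_normed_vector set"
  assumes K: "convex K" and S: "finite S" "S \<noteq> {}" "S \<subseteq> K"
    and closed: "\<And>y. y \<in> S \<Longrightarrow> closedin (subtopology weak_topology K) (G y)"
    and cover: "\<And>T. T \<subseteq> S \<Longrightarrow> convex hull T \<subseteq> (\<Union>y\<in>T. G y)"
  shows "\<exists>x\<in>convex hull S. \<forall>y\<in>S. x \<in> G y"
proof -
  define n where "n = card S"
  obtain h where "bij_betw h {0..<n} S" using ex_bij_betw_nat_finite[OF S(1)] n_def by blast
  then have h: "bij_betw h {..<n} S" by (simp add: atLeast0LessThan)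
  then have hS: "h i \<in> S" if "i < n" for i using that by (auto simp: bij_betw_def)
  define L where "L x = (\<Sum>i<n. x i *\<^sub>R h i)" for x :: "nat \<Rightarrow> real"
  have L_hull: "L x \<in> convex hull S" if "x \<in> std_simplex n" for x
    unfolding L_def using that hS
    by (intro convex_sum) (auto simp: std_simplex_def hull_inc)
  have hull_K: "convex hull S \<subseteq> K" using S(3) K by (rule hull_minimal)
  have coord: "continuous_on UNIV (\<lambda>x :: nat \<Rightarrow> real. x i)" for i by simp
  have "continuous_map euclidean weak_topology L"
  proof (rule continuous_map_into_weak_topology)
    fix f :: "'a \<Rightarrow>\<^sub>L real"
    have "continuous_on UNIV (\<lambda>x. \<Sum>i<n. x i * f (h i))"
      by (intro continuous_on_sum continuous_on_mult coord continuous_on_const)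
    then show "continuous_map euclidean euclidean (\<lambda>x. f (L x))"
      by (simp add: L_def blinfun.sum_right blinfun.scaleR_right)
  qed
  then have L_cont: "continuous_map (top_of_set (std_simplex n)) (subtopology weak_topology K) L"
    using L_hull hull_K by (auto simp: continuous_map_in_subtopology intro: continuous_map_from_subtopology)
  have "closed (std_simplex n)"
  proof -
    have "std_simplex n = (\<Inter>i. {x. 0 \<le> x i}) \<inter> (\<Inter>i\<in>{n..}. {x. x i = 0}) \<inter> {x. (\<Sum>i<n. x i) = 1}"
      by (auto simp: std_simplex_def)
    moreover have "closed \<dots>"
      by (intro closed_Int closed_INT ballI closed_Collect_le closed_Collect_eq continuous_on_sum
          coord continuous_on_const)
    ultimately show ?thesis by simp
  qed
  define F where "F i = {x \<in> std_simplex n. L x \<in> G (h i)}" for i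
  have "\<exists>x\<in>std_simplex n. \<forall>i<n. x \<in> F i"
  proof (rule kkm_simplex)
    show "n > 0" using S by (simp add: n_def card_gt_0_iff)
  next
    fix i assume "i < n"
    then have "closedin (top_of_set (std_simplex n)) {x \<in> topspace (top_of_set (std_simplex n)). L x \<in> G (h i)}"
      by (intro closedin_continuous_map_preimage[OF L_cont] closed hS)
    then have "closedin (top_of_set (std_simplex n)) (F i)" by (simp add: F_def)
    then show "closed (F i)" using \<open>closed (std_simplex n)\<close> by (rule closedin_closed_trans)
  next
    fix x assume x: "x \<in> std_simplex n"
    \<comment> \<open>Only vertices of positive weight contribute to \<open>L x\<close>. Covering
      the hull of these yields an index with \<open>0 < x i\<close>, as \<open>kkm_simplex\<close>
      demands.\<close>
    define I where "I = {i \<in> {..<n}. 0 < x i}"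
    have zero: "x i = 0" if "i \<in> {..<n} - I" for i
      using x that by (auto simp: std_simplex_def I_def order_le_less)
    have "I \<subseteq> {..<n}" by (auto simp: I_def)
    then have "(\<Sum>i\<in>I. x i) = (\<Sum>i<n. x i)" "(\<Sum>i\<in>I. x i *\<^sub>R h i) = L x"
      unfolding L_def using zero by (auto intro!: sum.mono_neutral_left)
    moreover have "(\<Sum>i\<in>I. x i *\<^sub>R h i) \<in> convex hull (h ` I)"
      using x calculation(1) by (intro convex_sum) (auto simp: std_simplex_def I_def hull_inc)
    ultimately have "L x \<in> convex hull (h ` I)" by simp
    moreover have "h ` I \<subseteq> S" using hS by (auto simp: I_def)
    ultimately obtain i where "i \<in> I" "L x \<in> G (h i)" using cover[of "h ` I"] by blast
    then show "\<exists>i<n. 0 < x i \<and> x \<in> F i" using x by (auto simp: I_def F_def)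
  qed
  then obtain x where x: "x \<in> std_simplex n" "\<And>i. i < n \<Longrightarrow> L x \<in> G (h i)" by (auto simp: F_def)
  have "L x \<in> G y" if "y \<in> S" for y
    using that h x(2) by (auto simp: bij_betw_def)
  with L_hull[OF x(1)] show ?thesis by blast
qed

theorem theorem4p7:
  fixes K D :: "'a::banach set"
    and \<phi> :: "'a \<Rightarrow> 'a \<Rightarrow> real"
  assumes "reflexive_space TYPE('a)"
    and "K \<noteq> {}" and "convex K" and "closed K"
    and "self_segment_dense weak_topology D K"
    and "\<And>y. y \<in> D \<Longrightarrow> weakly_usc_on K K (\<lambda>x. \<phi> x y)"
    and "\<And>x. x \<in> K \<Longrightarrow> weakly_usc_on K (K - D) (\<lambda>y. \<phi> x y)"
    and "\<And>x. x \<in> K \<Longrightarrow> convex_fun_on D (\<lambda>y. \<phi> x y)"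
    and "\<And>x. x \<in> D \<Longrightarrow> \<phi> x x \<ge> 0"
    and "\<exists>r>0. (\<exists>x\<in>K. norm x \<le> r) \<and>
           (\<forall>x\<in>K. norm x \<le> r \<longrightarrow> (\<exists>y0\<in>D. norm y0 < r \<and> \<phi> x y0 = 0))"
  shows "\<exists>x0\<in>K. \<forall>y\<in>K. \<phi> x0 y \<ge> 0"
proof -
  note dense = assms(5) and usc1 = assms(6) and usc2 = assms(7) and conv = assms(8) and diag = assms(9)
  have DK: "D \<subseteq> K" and cl: "K \<subseteq> weak_topology closure_of D"
    using dense by (auto simp: self_segment_dense_def)
  obtain r where "\<exists>x\<in>K. norm x \<le> r"
    and zero: "\<And>x. x \<in> K \<Longrightarrow> norm x \<le> r \<Longrightarrow> \<exists>y0\<in>D. norm y0 < r \<and> \<phi> x y0 = 0"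
    using assms(10) by blast
  define B where "B = K \<inter> cball 0 r"
  have B: "convex B" "closed B" "bounded B" "B \<noteq> {}"
    using assms(3,4) \<open>\<exists>x\<in>K. norm x \<le> r\<close>
    by (auto simp: B_def convex_Int closed_Int bounded_Int)
  define G where "G y = {x \<in> K. 0 \<le> \<phi> x y}" for y
  have G_closed: "closedin (subtopology weak_topology K) (G y)" if "y \<in> D" for y
    unfolding G_def by (rule closedin_weakly_usc[OF usc1[OF that]])
  have cover: "convex hull T \<subseteq> (\<Union>y\<in>T. G y)" if T: "finite T" "T \<subseteq> D" for T
  proof -
    have hull_K: "convex hull T \<subseteq> K" using T DK \<open>convex K\<close> by (intro hull_minimal) auto
    have sub: "convex hull T \<inter> D \<subseteq> (\<Union>y\<in>T. G y)"
    proof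
      fix x assume x: "x \<in> convex hull T \<inter> D"
      then obtain u where u: "\<And>y. y \<in> T \<Longrightarrow> 0 \<le> u y" "sum u T = 1" and xe: "(\<Sum>y\<in>T. u y *\<^sub>R y) = x"
        by (auto simp: convex_hull_finite[OF T(1)])
      have "x \<in> K" using x DK by blast
      have le: "\<phi> x x \<le> (\<Sum>y\<in>T. u y * \<phi> x y)"
        using convex_fun_on_finite[OF conv[OF \<open>x \<in> K\<close>] T, of u] u x xe by simp
      show "x \<in> (\<Union>y\<in>T. G y)"
      proof (rule ccontr)
        assume "x \<notin> (\<Union>y\<in>T. G y)"
        then have neg: "\<phi> x y < 0" if "y \<in> T" for y using that \<open>x \<in> K\<close> by (auto simp: G_def not_le)
        \<comment> \<open>The weights sum to 1, so one is positive; this makes the combination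
          strictly negative, against \<open>\<phi> x x \<ge> 0\<close>.\<close>
        obtain y where y: "y \<in> T" "u y > 0"
          using u by (metis less_le sum.neutral zero_neq_one)
        have "(\<Sum>y\<in>T. u y * \<phi> x y) < (\<Sum>y\<in>T. 0)"
        proof (rule sum_strict_mono_ex1[OF T(1)])
          show "\<forall>y\<in>T. u y * \<phi> x y \<le> 0" using u neg by (auto simp: mult_nonneg_nonpos less_imp_le)
          show "\<exists>y\<in>T. u y * \<phi> x y < 0" using y neg mult_pos_neg by blast
        qed
        with le diag[of x] x show False by simp
      qed
    qed
    \<comment> \<open>A finite union of closed sets is closed, so the covering of
      \<open>convex hull T \<inter> D\<close> extends to its weak closure in \<open>K\<close>, which
      contains the hull.\<close>
    have "closedin (subtopology weak_topology K) (\<Union>y\<in>T. G y)"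
      using T G_closed by (intro closedin_Union) auto
    then have "subtopology weak_topology K closure_of (convex hull T \<inter> D) \<subseteq> (\<Union>y\<in>T. G y)"
      using sub by (intro closure_of_minimal)
    moreover have "convex hull T \<subseteq> subtopology weak_topology K closure_of (convex hull T \<inter> D)"
    proof -
      have "K \<inter> (convex hull T \<inter> D) = convex hull T \<inter> D" using DK by blast
      then show ?thesis
        using self_segment_dense_hull[OF dense T] hull_K by (simp add: closure_of_subtopology)
    qed
    ultimately show ?thesis by blast
  qed
  \<comment> \<open>With indices of norm below \<open>r\<close>, hulls of finite subsets stay in the
    weakly compact set \<open>B\<close>, so the finite intersection property can be used
    there.\<close>
  define Y where "Y = {y \<in> D. norm y < r}"
  have "compactin (subtopology weak_topology K) B"
    using compactin_weak_convex_closed_bounded[OF assms(1) B(1-3)] by (simp add: compactin_subtopology B_def)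
  moreover have "\<forall>C\<in>G ` Y. closedin (subtopology weak_topology K) C"
    using G_closed by (auto simp: Y_def)
  moreover have "B \<inter> \<Inter>\<F> \<noteq> {}" if "finite \<F>" "\<F> \<subseteq> G ` Y" for \<F>
  proof -
    obtain S where S: "S \<subseteq> Y" "finite S" "\<F> = G ` S" using finite_subset_image[OF \<open>finite \<F>\<close> \<open>\<F> \<subseteq> G ` Y\<close>] by blast
    show ?thesis
    proof (cases "S = {}")
      case True
      then show ?thesis using S B by simp
    next
      case False
      have SD: "S \<subseteq> D" using S by (auto simp: Y_def)
      have "\<exists>x\<in>convex hull S. \<forall>y\<in>S. x \<in> G y"
        using SD DK S(2) False
        by (intro knaster_kuratowski_mazurkiewicz[OF \<open>convex K\<close>] G_closed cover)
          (auto intro: finite_subset)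
      moreover have "convex hull S \<subseteq> B"
        using S DK B(1) by (intro hull_minimal) (auto simp: Y_def B_def)
      ultimately show ?thesis using S by blast
    qed
  qed
  ultimately have "B \<inter> \<Inter>(G ` Y) \<noteq> {}" unfolding compactin_fip by blast
  then obtain x0 where x0: "x0 \<in> B" and nonneg: "\<And>y. y \<in> D \<Longrightarrow> norm y < r \<Longrightarrow> 0 \<le> \<phi> x0 y"
    by (auto simp: G_def Y_def)
  have x0K: "x0 \<in> K" "norm x0 \<le> r" using x0 by (auto simp: B_def)
  then obtain y0 where y0: "y0 \<in> D" "norm y0 < r" "\<phi> x0 y0 = 0" using zero by blast
  have "0 \<le> \<phi> x0 y" if y: "y \<in> D" for y
  proof (cases "y = y0")
    case True
    then show ?thesis using y0 by simp
  next
    case False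
    \<comment> \<open>A step \<open>t\<close> below the quotient moves \<open>y0\<close> by less
      than \<open>r - norm y0\<close>; the bound 1 keeps \<open>t\<close> a convex weight.\<close>
    define \<delta> where "\<delta> = min 1 ((r - norm y0) / norm (y - y0))"
    have "0 < \<delta>" "\<delta> \<le> 1" using False y0 by (auto simp: \<delta>_def)
    then obtain t where t: "0 < t" "t < \<delta>" and z: "(1 - t) *\<^sub>R y0 + t *\<^sub>R y \<in> D"
      using self_segment_dense_approach[OF dense y0(1) y] False by metis
    have "t * norm (y - y0) < r - norm y0"
      using t False by (simp add: \<delta>_def less_divide_eq)
    moreover have "(1 - t) *\<^sub>R y0 + t *\<^sub>R y = y0 + t *\<^sub>R (y - y0)" by (simp add: algebra_simps)
    ultimately have "norm ((1 - t) *\<^sub>R y0 + t *\<^sub>R y) < r"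
      using norm_triangle_ineq[of y0 "t *\<^sub>R (y - y0)"] t by simp
    then have "0 \<le> \<phi> x0 ((1 - t) *\<^sub>R y0 + t *\<^sub>R y)" by (rule nonneg[OF z])
    \<comment> \<open>Since \<open>\<phi> x0 y0 = 0\<close>, only \<open>t * \<phi> x0 y\<close>
      remains on the right, and \<open>t\<close> is positive.\<close>
    also have "\<dots> \<le> (1 - t) * \<phi> x0 y0 + t * \<phi> x0 y"
      using t \<open>\<delta> \<le> 1\<close> by (intro convex_fun_on_two[OF conv[OF x0K(1)] y0(1) y _ _ z]) auto
    finally show ?thesis using t y0 by (simp add: zero_le_mult_iff)
  qed
  then have "\<forall>y\<in>K. 0 \<le> \<phi> x0 y"
    using weakly_usc_nonneg_extend[OF usc2[OF x0K(1)] cl DK] by blast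
  with x0K show ?thesis by blast
qed

end
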